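(* For every positive integer $d$, $C(d,2)=\Gamma_d$. Equivalently, for every positive integer $d$, \[ C(d,2)=\sup_{s\ge1}\ \sup_{\substack{0\ne H\in\mathbb C[t_1,\ldots,t_s]\\ \deg H\le d}}\frac{\|H\|_{\mathbb T^s}}{\|H\|_{[-1,1]^s}}. \]
   Context: Let $\mathbb T=\{z\in\mathbb C:|z|=1\}$. For a polynomial $P:\mathbb C^N\to\mathbb C$ and a nonempty compact set $E\subset\mathbb C^N$, put $\|P\|_E=\max_{z\in E}|P(z)|$. The sets $[-1,1]^N$ and $\{-1,1\}^N$ are regarded as subsets of $\mathbb C^N$. For integers $N\ge d\ge1$, let $\mathcal P_{N,d}^{\mathrm{mult}}$ be the set of multiaffine polynomials $P:\mathbb C^N\to\mathbb C$ with complex coefficients and total degree at most $d$, i.e. \[ P(z)=\sum_{\substack{\alpha\in\{0,1\}^N\\ |\alpha|\le d}}c_\alpha z^\alpha,\qquad c_\alpha\in\mathbb C, \] where $|\alpha|=\alpha_1+\cdots+\alpha_N$ and $z^\alpha=z_1^{\alpha_1}\cdots z_N^{\alpha_N}$. Define \[ C(d,2):=\sup_{N\ge d}\ \sup_{0\ne P\in\mathcal P_{N,d}^{\mathrm{mult}}}\frac{\|P\|_{\mathbb T^N}}{\|P\|_{\{-1,1\}^N}}. \] For $d\ge1$ define \[ \Gamma_d:=\sup_{s\ge1}\ \sup_{\substack{0\ne H\in\mathbb C[t_1,\ldots,t_s]\\ \deg H\le d}}\frac{\|H\|_{\mathbb T^s}}{\|H\|_{[-1,1]^s}}, \] where $\deg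 H$ denotes total degree. *)

theory Defs
  imports "HOL-Analysis.Analysis" "HOL-Library.Poly_Mapping"
begin

type_synonym monom = "nat \<Rightarrow>\<^sub>0 nat"
type_synonym cpoly = "monom \<Rightarrow>\<^sub>0 complex"

text \<open>
  An exponent vector is a finitely supported map from variable indices to exponents, and a
  polynomial is a finitely supported map from exponent vectors to coefficients.
  The variables of a polynomial in \<open>n\<close> variables have indices \<open>0, \<dots>, n - 1\<close>.
\<close>

definition cpolys :: "nat \<Rightarrow> cpoly set" where
  "cpolys n = {P. \<forall>\<alpha>\<in>Poly_Mapping.keys P. Poly_Mapping.keys \<alpha> \<subseteq> {..<n}}"

definition monom_degree :: "monom \<Rightarrow> nat" where
  "monom_degree \<alpha> = (\<Sum>i\<in>Poly_Mapping.keys \<alpha>. Poly_Mapping.lookup \<alpha> i)"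

definition total_degree_le :: "nat \<Rightarrow> cpoly \<Rightarrow> bool" where
  "total_degree_le d P \<longleftrightarrow> (\<forall>\<alpha>\<in>Poly_Mapping.keys P. monom_degree \<alpha> \<le> d)"

definition multiaffine :: "cpoly \<Rightarrow> bool" where
  "multiaffine P \<longleftrightarrow>
     (\<forall>\<alpha>\<in>Poly_Mapping.keys P. \<forall>i. Poly_Mapping.lookup \<alpha> i \<in> {0, 1})"

definition cpoly_eval :: "cpoly \<Rightarrow> (nat \<Rightarrow> complex) \<Rightarrow> complex" where
  "cpoly_eval P z =
     (\<Sum>\<alpha>\<in>Poly_Mapping.keys P. Poly_Mapping.lookup P \<alpha> *
        (\<Prod>i\<in>Poly_Mapping.keys \<alpha>. z i ^ Poly_Mapping.lookup \<alpha> i))"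

text \<open>
  Points of complex \<open>n\<close>-space are extensional functions on \<open>{..<n}\<close>; the power \<open>A\<^sup>n\<close> of a set
  \<open>A\<close> of complex numbers is the corresponding \<open>PiE\<close>.
\<close>

definition cpower :: "complex set \<Rightarrow> nat \<Rightarrow> (nat \<Rightarrow> complex) set" where
  "cpower A n = PiE {..<n} (\<lambda>_. A)"

definition torus :: "nat \<Rightarrow> (nat \<Rightarrow> complex) set" where
  "torus n = cpower {z. cmod z = 1} n"

definition real_cube :: "nat \<Rightarrow> (nat \<Rightarrow> complex) set" where
  "real_cube n = cpower (complex_of_real ` {-1..1}) n"

definition sign_cube :: "nat \<Rightarrow> (nat \<Rightarrow> complex) set" where
  "sign_cube n = cpower {-1, 1} n"

text \<open>
  The supremum below is a maximum for the three families of sets above, as these sets are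
  nonempty and compact and polynomials are continuous.
\<close>

definition sup_norm_on :: "(nat \<Rightarrow> complex) set \<Rightarrow> cpoly \<Rightarrow> real" where
  "sup_norm_on E P = (SUP z\<in>E. cmod (cpoly_eval P z))"

text \<open>
  The suprema of quotients are taken in the extended reals, so that no boundedness is presupposed.
  The quotients themselves are real: the denominators are positive because a multiaffine polynomial
  vanishing on \<open>{-1, 1}\<^sup>N\<close>, or any polynomial vanishing on \<open>[-1, 1]\<^sup>s\<close>, is zero.
\<close>

definition multiaffine_polys :: "nat \<Rightarrow> nat \<Rightarrow> cpoly set" where
  "multiaffine_polys N d = {P \<in> cpolys N. multiaffine P \<and> total_degree_le d P}"

definition sign_cube_const :: "nat \<Rightarrow> ereal" where
  "sign_cube_const d =
     (SUP N\<in>{d..}. SUP P\<in>multiaffine_polys N d - {0}.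
        ereal (sup_norm_on (torus N) P / sup_norm_on (sign_cube N) P))"

definition real_cube_const :: "nat \<Rightarrow> ereal" where
  "real_cube_const d =
     (SUP s\<in>{1..}. SUP H\<in>{H \<in> cpolys s. total_degree_le d H} - {0}.
        ereal (sup_norm_on (torus s) H / sup_norm_on (real_cube s) H))"

end

theory Submission
  imports Defs
begin

text \<open>
  A multiaffine polynomial is affine in each variable, so its maximum over the real cube is attained
  at a vertex; this gives one inequality.

  For the other, split each variable \<open>t\<^sub>j\<close> of \<open>H\<close> into \<open>n\<close> variables \<open>x\<^sub>j\<^sub>1, \<dots>, x\<^sub>j\<^sub>n\<close>.
  Substituting the means of these groups for the \<open>t\<^sub>j\<close> turns a monomial of degree \<open>m\<close> into an
  average of products over all maps from an \<open>m\<close>-element set to \<open>{..<n}\<close>. Averaging over the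
  injective maps only gives a multiaffine polynomial which still restricts to \<open>H\<close> on the diagonal
  and which differs from \<open>H(means)\<close> by \<open>o(1)\<close> on the sign cube, since almost all maps are injective
  for large \<open>n\<close>. As the means lie in \<open>[-1, 1]\<close>, the quotient of \<open>H\<close> is a limit of lower bounds for
  quotients of multiaffine polynomials.
\<close>

section \<open>Evaluation and sup norms\<close>

abbreviation monom_eval :: "monom \<Rightarrow> (nat \<Rightarrow> complex) \<Rightarrow> complex" where
  "monom_eval \<alpha> z \<equiv> (\<Prod>i\<in>Poly_Mapping.keys \<alpha>. z i ^ Poly_Mapping.lookup \<alpha> i)"

lemma cpoly_eval_add: "cpoly_eval (P + Q) z = cpoly_eval P z + cpoly_eval Q z"
  unfolding cpoly_eval_def
  by (rule setsum_keys_plus_distrib[where f = "\<lambda>\<alpha> c. c * monom_eval \<alpha> z"])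
     (auto simp: distrib_right)

lemma cpoly_eval_0 [simp]: "cpoly_eval 0 z = 0"
  by (simp add: cpoly_eval_def)

lemma cpoly_eval_sum: "cpoly_eval (\<Sum>i\<in>I. P i) z = (\<Sum>i\<in>I. cpoly_eval (P i) z)"
  by (induction I rule: infinite_finite_induct) (auto simp: cpoly_eval_add)

lemma cpoly_eval_single: "cpoly_eval (Poly_Mapping.single \<alpha> c) z = c * monom_eval \<alpha> z"
  by (simp add: cpoly_eval_def)

lemma norm_monom_eval_le:
  assumes "\<And>i. i \<in> Poly_Mapping.keys \<alpha> \<Longrightarrow> cmod (z i) \<le> 1"
  shows "cmod (monom_eval \<alpha> z) \<le> 1"
  unfolding prod_norm[symmetric] norm_power
  by (intro prod_le_1) (auto simp: assms power_le_one)

text \<open>A crude bound, independent of \<open>z\<close>: it makes the set of values bounded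
  above, so that the real supremum in \<open>sup_norm_on\<close> dominates each value.\<close>

lemma norm_cpoly_eval_le:
  assumes P: "P \<in> cpolys n" and z: "z \<in> cpower (cball 0 1) n"
  shows "cmod (cpoly_eval P z) \<le> (\<Sum>\<alpha>\<in>Poly_Mapping.keys P. cmod (Poly_Mapping.lookup P \<alpha>))"
  unfolding cpoly_eval_def
proof (rule sum_norm_le)
  fix \<alpha> assume "\<alpha> \<in> Poly_Mapping.keys P"
  then have "cmod (monom_eval \<alpha> z) \<le> 1"
    using P z by (intro norm_monom_eval_le) (auto simp: cpolys_def cpower_def PiE_iff)
  then show "cmod (Poly_Mapping.lookup P \<alpha> * monom_eval \<alpha> z) \<le> cmod (Poly_Mapping.lookup P \<alpha>)"
    by (simp add: norm_mult mult_left_le)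
qed

lemma norm_cpoly_eval_le_sup_norm_on:
  assumes "P \<in> cpolys n" "E \<subseteq> cpower (cball 0 1) n" "z \<in> E"
  shows "cmod (cpoly_eval P z) \<le> sup_norm_on E P"
  unfolding sup_norm_on_def
  using assms norm_cpoly_eval_le[OF assms(1)] by (intro cSUP_upper bdd_aboveI2) blast+

lemma sup_norm_on_le:
  assumes "E \<noteq> {}" "\<And>z. z \<in> E \<Longrightarrow> cmod (cpoly_eval P z) \<le> B"
  shows "sup_norm_on E P \<le> B"
  unfolding sup_norm_on_def using assms by (intro cSUP_least)

lemma sup_norm_on_nonneg:
  assumes "P \<in> cpolys n" "E \<subseteq> cpower (cball 0 1) n" "E \<noteq> {}"
  shows "0 \<le> sup_norm_on E P"
proof -
  obtain z where "z \<in> E" using assms(3) by blast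
  from norm_cpoly_eval_le_sup_norm_on[OF assms(1,2) this] show ?thesis
    by (rule order_trans[OF norm_ge_zero])
qed

section \<open>Inclusions among the torus, the cubes and the closed unit polydisc\<close>

lemma cpower_mono: "A \<subseteq> B \<Longrightarrow> cpower A n \<subseteq> cpower B n"
  unfolding cpower_def by (intro PiE_mono) auto

lemma torus_subset: "torus n \<subseteq> cpower (cball 0 1) n"
  unfolding torus_def by (intro cpower_mono) auto

lemma real_cube_subset: "real_cube n \<subseteq> cpower (cball 0 1) n"
  unfolding real_cube_def by (intro cpower_mono) auto

lemma sign_cube_subset: "sign_cube n \<subseteq> real_cube n"
  unfolding sign_cube_def real_cube_def
  by (intro cpower_mono) (auto simp: image_iff intro: bexI[of _ 1] bexI[of _ "-1"])

lemma sign_cube_subset_unit: "sign_cube n \<subseteq> cpower (cball 0 1) n"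
  using sign_cube_subset real_cube_subset by (rule order_trans)

lemma cpower_nonempty: "A \<noteq> {} \<Longrightarrow> cpower A n \<noteq> {}"
  by (simp add: cpower_def PiE_eq_empty_iff)

lemma torus_nonempty: "torus n \<noteq> {}"
  unfolding torus_def by (intro cpower_nonempty) (auto intro: exI[of _ 1])

lemma sign_cube_nonempty: "sign_cube n \<noteq> {}"
  unfolding sign_cube_def by (intro cpower_nonempty) auto

lemma real_cube_nonempty: "real_cube n \<noteq> {}"
  using sign_cube_nonempty sign_cube_subset by blast

section \<open>Multiaffine polynomials\<close>

text \<open>Each monomial contains variable \<open>i\<close> to the power 0 or 1, so the value is
  affine in \<open>t\<close> and is recovered by linear interpolation from the nodes 1 and
  -1.\<close>

lemma multiaffine_eval_affine:
  assumes "multiaffine P"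
  shows "cpoly_eval P (z(i := t)) =
    (1 + t) / 2 * cpoly_eval P (z(i := 1)) + (1 - t) / 2 * cpoly_eval P (z(i := -1))"
proof -
  have "monom_eval \<alpha> (z(i := t)) =
      (1 + t) / 2 * monom_eval \<alpha> (z(i := 1)) + (1 - t) / 2 * monom_eval \<alpha> (z(i := -1))"
    if "\<alpha> \<in> Poly_Mapping.keys P" for \<alpha>
  proof (cases "i \<in> Poly_Mapping.keys \<alpha>")
    case True
    have "Poly_Mapping.lookup \<alpha> i \<in> {0, 1}"
      using assms that unfolding multiaffine_def by blast
    with True have 1: "Poly_Mapping.lookup \<alpha> i = 1"
      by (auto simp: in_keys_iff)
    have "monom_eval \<alpha> (z(i := u)) =
        u * (\<Prod>j\<in>Poly_Mapping.keys \<alpha> - {i}. z j ^ Poly_Mapping.lookup \<alpha> j)" for u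
      using True by (subst prod.remove[of _ i]) (auto simp: 1 intro!: prod.cong)
    then show ?thesis by (simp add: field_simps)
  next
    case False
    have "monom_eval \<alpha> (z(i := u)) = monom_eval \<alpha> z" for u
      using False by (intro prod.cong) auto
    then show ?thesis by (simp add: field_simps)
  qed
  then show ?thesis
    unfolding cpoly_eval_def sum_distrib_left sum.distrib[symmetric]
    by (intro sum.cong) (auto simp: algebra_simps)
qed

text \<open>
  The hypothesis on \<open>D\<close> holds for \<open>D = [-1, 1]\<close> and every \<open>B\<close>, and for every \<open>D\<close> if \<open>B = 0\<close>.
\<close>

lemma multiaffine_bound:
  assumes P: "multiaffine P"
    and B: "\<And>z. z \<in> sign_cube n \<Longrightarrow> cmod (cpoly_eval P z) \<le> B"
    and D: "\<And>t. t \<in> D \<Longrightarrow> (cmod (1 + t) + cmod (1 - t)) * B \<le> 2 * B"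
    and z: "z \<in> cpower D n"
  shows "cmod (cpoly_eval P z) \<le> B"
proof -
  \<comment> \<open>Coordinates are released from {-1, 1} to \<open>D\<close> one at a time; after
    \<open>k\<close> steps the first \<open>k\<close> are free.\<close>
  have "k \<le> n \<Longrightarrow> \<forall>z\<in>PiE {..<n} (\<lambda>i. if i < k then D else {-1, 1}). cmod (cpoly_eval P z) \<le> B"
    for k
  proof (induction k)
    case 0
    then show ?case using B by (simp add: sign_cube_def cpower_def)
  next
    case (Suc k)
    show ?case
    proof
      fix z assume z: "z \<in> PiE {..<n} (\<lambda>i. if i < Suc k then D else {-1, 1})"
      have "z(k := u) \<in> PiE {..<n} (\<lambda>i. if i < k then D else {-1, 1})" if "u \<in> {-1, 1}" for u
      proof (rule PiE_I)
        fix i assume "i \<in> {..<n}"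
        with z have "z i \<in> (if i < Suc k then D else {-1, 1})" by (rule PiE_mem)
        with that show "(z(k := u)) i \<in> (if i < k then D else {-1, 1})"
          by (cases "i = k") (simp_all add: less_Suc_eq split: if_splits)
      next
        fix i assume "i \<notin> {..<n}"
        with PiE_arb[OF z this] Suc.prems show "(z(k := u)) i = undefined" by auto
      qed
      then have IH: "cmod (cpoly_eval P (z(k := 1))) \<le> B" "cmod (cpoly_eval P (z(k := -1))) \<le> B"
        using Suc.IH Suc.prems by (meson Suc_leD insertI1 insertI2)+
      have "z k \<in> D" using PiE_mem[OF z, of k] Suc.prems by simp
      have "cmod (cpoly_eval P z) = cmod (cpoly_eval P (z(k := z k)))" by simp
      also have "\<dots> \<le> cmod ((1 + z k) / 2) * cmod (cpoly_eval P (z(k := 1))) +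
          cmod ((1 - z k) / 2) * cmod (cpoly_eval P (z(k := -1)))"
        unfolding multiaffine_eval_affine[OF P, of z k "z k"] norm_mult[symmetric]
        by (rule norm_triangle_ineq)
      also have "\<dots> \<le> cmod ((1 + z k) / 2) * B + cmod ((1 - z k) / 2) * B"
        using IH by (intro add_mono mult_left_mono) auto
      also have "\<dots> \<le> B"
        using D[OF \<open>z k \<in> D\<close>] by (simp add: norm_divide distrib_right)
      finally show "cmod (cpoly_eval P z) \<le> B" .
    qed
  qed
  moreover have "z \<in> PiE {..<n} (\<lambda>i. if i < n then D else {-1, 1})"
    using z by (simp add: cpower_def PiE_iff)
  ultimately show ?thesis by blast
qed

lemma sup_norm_on_real_cube_multiaffine:
  assumes "P \<in> cpolys n" "multiaffine P"
  shows "sup_norm_on (real_cube n) P = sup_norm_on (sign_cube n) P"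
proof (rule antisym)
  \<comment> \<open>For real t in [-1, 1] the interpolation weights (1 + t)/2 and (1 - t)/2 are
    nonnegative with sum 1, so the bound holds with equality.\<close>
  have D: "(cmod (1 + t) + cmod (1 - t)) * B \<le> 2 * B"
    if "t \<in> complex_of_real ` {-1..1}" for t B
  proof -
    from that obtain r where "t = of_real r" "-1 \<le> r" "r \<le> 1" by auto
    moreover have "cmod (1 + of_real r) = \<bar>1 + r\<bar>" "cmod (1 - of_real r) = \<bar>1 - r\<bar>"
      using norm_of_real[of "1 + r", where ?'a = complex] norm_of_real[of "1 - r", where ?'a = complex]
      by simp_all
    ultimately show ?thesis by simp
  qed
  show "sup_norm_on (real_cube n) P \<le> sup_norm_on (sign_cube n) P"
  proof (rule sup_norm_on_le[OF real_cube_nonempty])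
    fix z assume "z \<in> real_cube n"
    then have z: "z \<in> cpower (complex_of_real ` {-1..1}) n" by (simp add: real_cube_def)
    show "cmod (cpoly_eval P z) \<le> sup_norm_on (sign_cube n) P"
      by (rule multiaffine_bound[OF assms(2) _ _ z])
         (rule norm_cpoly_eval_le_sup_norm_on[OF assms(1) sign_cube_subset_unit] D, assumption)+
  qed
  show "sup_norm_on (sign_cube n) P \<le> sup_norm_on (real_cube n) P"
    using sign_cube_subset
    by (intro sup_norm_on_le[OF sign_cube_nonempty]
          norm_cpoly_eval_le_sup_norm_on[OF assms(1) real_cube_subset]) blast
qed

text \<open>If the norm on the sign cube were 0, \<open>multiaffine_bound\<close> with
  \<open>B = 0\<close> and \<open>D = UNIV\<close> would force \<open>P\<close> to vanish at
  \<open>z\<close>. This later keeps denominators positive.\<close>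

lemma sup_norm_on_sign_cube_pos:
  assumes "P \<in> cpolys n" "multiaffine P" and z: "z \<in> torus n" "cpoly_eval P z \<noteq> 0"
  shows "sup_norm_on (sign_cube n) P > 0"
proof (rule ccontr)
  assume *: "\<not> ?thesis"
  have "cmod (cpoly_eval P z) \<le> 0"
  proof (rule multiaffine_bound[OF assms(2), where D = UNIV])
    show "z \<in> cpower UNIV n"
      using z(1) cpower_mono[of "{z. cmod z = 1}" UNIV n] by (auto simp: torus_def)
    show "cmod (cpoly_eval P x) \<le> 0" if "x \<in> sign_cube n" for x
      using norm_cpoly_eval_le_sup_norm_on[OF assms(1) sign_cube_subset_unit that] * by linarith
  qed auto
  with z(2) show False by simp
qed

section \<open>Averages over injective maps\<close>

text \<open>Two errors of size at most 1 - |I|/|A| add up: the weights on \<open>I\<close> change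
  from 1/|A| to 1/|I|, and the terms outside \<open>I\<close> are dropped.\<close>

lemma norm_average_subset_diff_le:
  fixes g :: "'a \<Rightarrow> complex"
  assumes A: "finite A" and I: "I \<subseteq> A" "I \<noteq> {}" and g: "\<And>a. a \<in> A \<Longrightarrow> cmod (g a) \<le> 1"
  shows "cmod (sum g I / card I - sum g A / card A) \<le> 2 * (1 - card I / card A)"
proof -
  have finI: "finite I" using A I finite_subset by blast
  have pos: "card I > 0" "card A > 0" and le: "card I \<le> card A"
    using A I finI by (auto simp: card_gt_0_iff card_mono)
  have split: "sum g A = sum g I + sum g (A - I)"
    using A I by (simp add: sum.subset_diff add.commute)
  have "sum g I / card I - sum g A / card A
      = sum g I * of_real (1 / card I - 1 / card A) - sum g (A - I) / card A"
    by (simp add: split right_diff_distrib add_divide_distrib diff_diff_eq)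
  also have "cmod \<dots> \<le> cmod (sum g I) * \<bar>1 / card I - 1 / card A\<bar> + cmod (sum g (A - I)) / card A"
    by (rule order_trans[OF norm_triangle_ineq4])
       (simp only: norm_mult norm_of_real norm_divide norm_of_nat)
  also have "\<dots> \<le> card I * (1 / card I - 1 / card A) + card (A - I) / card A"
  proof (intro add_mono mult_mono divide_right_mono)
    show "cmod (sum g I) \<le> card I"
      using sum_norm_bound[of I g 1] g I by auto
    show "cmod (sum g (A - I)) \<le> card (A - I)"
      using sum_norm_bound[of "A - I" g 1] g by auto
    show "\<bar>1 / card I - 1 / card A\<bar> \<le> 1 / card I - 1 / card A"
      using pos le by (simp add: field_simps)
  qed auto
  also have "\<dots> = 2 * (1 - card I / card A)"
  proof -
    have "a * (1 / a - 1 / b) + (b - a) / b = 2 * (1 - a / b)" if "a > 0" "b > 0" for a b :: real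
      using that by (simp add: field_simps)
    then show ?thesis
      using pos le I finI by (simp add: card_Diff_subset of_nat_diff)
  qed
  finally show ?thesis .
qed

section \<open>Counting injective maps\<close>

definition inj_maps :: "'a set \<Rightarrow> nat \<Rightarrow> ('a \<Rightarrow> nat) set" where
  "inj_maps S n = {f \<in> S \<rightarrow>\<^sub>E {..<n}. inj_on f S}"

lemma finite_inj_maps: "finite S \<Longrightarrow> finite (inj_maps S n)"
  by (simp add: inj_maps_def finite_PiE)

text \<open>The falling factorial; for \<open>n < card S\<close> truncated subtraction yields a
  factor 0, so the formula holds for every \<open>n\<close>.\<close>

lemma card_inj_maps:
  assumes "finite S"
  shows "card (inj_maps S n) = (\<Prod>i<card S. n - i)"
  using card_inj_on_subset_funcset[OF assms, of "{..<n}" S]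
  by (simp add: inj_maps_def atLeast0LessThan)

lemma inj_maps_nonempty:
  assumes "finite S" "card S \<le> n"
  shows "inj_maps S n \<noteq> {}"
proof -
  have "card (inj_maps S n) \<noteq> 0"
    using assms by (simp add: card_inj_maps)
  then show ?thesis by force
qed

text \<open>The ratio is the probability that a random map is injective. It equals a product of
  factors 1 - i/n whose number is fixed, and each factor tends to 1.\<close>

lemma inj_maps_ratio_tendsto:
  assumes "finite S"
  shows "(\<lambda>n. card (inj_maps S n) / real n ^ card S) \<longlonglongrightarrow> 1"
proof -
  have "(\<lambda>n. \<Prod>i<card S. 1 - real i / real n) \<longlonglongrightarrow> (\<Prod>i<card S. 1 - 0)"
    by (intro tendsto_intros lim_const_over_n)
  moreover have "\<forall>\<^sub>F n in sequentially.
      (\<Prod>i<card S. 1 - real i / real n) = card (inj_maps S n) / real n ^ card S"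
    using eventually_gt_at_top[of "card S"]
  proof eventually_elim
    case (elim n)
    have "card (inj_maps S n) / real n ^ card S = (\<Prod>i<card S. real (n - i) / real n)"
      by (simp add: card_inj_maps[OF assms] prod_dividef)
    also have "\<dots> = (\<Prod>i<card S. 1 - real i / real n)"
      using elim by (intro prod.cong) (auto simp: field_simps)
    finally show ?case by simp
  qed
  ultimately show ?thesis
    by (auto intro: Lim_transform_eventually)
qed

section \<open>Multiaffine lifts\<close>

text \<open>The pair (j, r) stands for the r-th occurrence of variable j, which makes a monomial of
  degree m a product over an m-element set.\<close>

definition slots :: "monom \<Rightarrow> (nat \<times> nat) set" where
  "slots \<alpha> = (SIGMA j:Poly_Mapping.keys \<alpha>. {..<Poly_Mapping.lookup \<alpha> j})"

lemma finite_slots [simp]: "finite (slots \<alpha>)"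
  by (simp add: slots_def)

lemma card_slots: "card (slots \<alpha>) = monom_degree \<alpha>"
  by (simp add: slots_def monom_degree_def card_SigmaI)

lemma prod_slots: "(\<Prod>p\<in>slots \<alpha>. z (fst p)) = monom_eval \<alpha> z"
proof -
  have "(\<Prod>p\<in>slots \<alpha>. z (fst p)) =
      (\<Prod>j\<in>Poly_Mapping.keys \<alpha>. \<Prod>r<Poly_Mapping.lookup \<alpha> j. z j)"
    unfolding slots_def by (subst prod.Sigma) (auto simp: case_prod_unfold)
  then show ?thesis by simp
qed

lemma in_keys_sumD:
  "\<beta> \<in> Poly_Mapping.keys (\<Sum>i\<in>I. P i) \<Longrightarrow> \<exists>i\<in>I. \<beta> \<in> Poly_Mapping.keys (P i)"
  using keys_sum[of P I] by blast

definition squarefree_monom :: "nat set \<Rightarrow> monom" where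
  "squarefree_monom A = (\<Sum>i\<in>A. Poly_Mapping.single i 1)"

lemma lookup_squarefree_monom:
  "finite A \<Longrightarrow> Poly_Mapping.lookup (squarefree_monom A) i = of_bool (i \<in> A)"
  by (simp add: squarefree_monom_def lookup_sum lookup_single when_def)

lemma keys_squarefree_monom: "finite A \<Longrightarrow> Poly_Mapping.keys (squarefree_monom A) = A"
  by (auto simp: in_keys_iff lookup_squarefree_monom)

text \<open>Variable \<open>k\<close> of the group replacing the variable \<open>j < s\<close> has index \<open>k * s + j\<close>.\<close>

definition slot_var :: "nat \<Rightarrow> (nat \<times> nat \<Rightarrow> nat) \<Rightarrow> nat \<times> nat \<Rightarrow> nat" where
  "slot_var s f p = f p * s + fst p"

text \<open>Different \<open>f\<close> may yield the same squarefree monomial, so the terms are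
  added as \<open>single\<close>s and their coefficients accumulate.\<close>

definition lift_poly :: "nat \<Rightarrow> nat \<Rightarrow> cpoly \<Rightarrow> cpoly" where
  "lift_poly s n H = (\<Sum>\<alpha>\<in>Poly_Mapping.keys H. \<Sum>f\<in>inj_maps (slots \<alpha>) n.
     Poly_Mapping.single (squarefree_monom (slot_var s f ` slots \<alpha>))
       (Poly_Mapping.lookup H \<alpha> / card (inj_maps (slots \<alpha>) n)))"

text \<open>Restricted to \<open>{..<s}\<close> because points of \<open>cpower\<close> are
  extensional.\<close>

definition group_mean :: "nat \<Rightarrow> nat \<Rightarrow> (nat \<Rightarrow> complex) \<Rightarrow> nat \<Rightarrow> complex" where
  "group_mean s n x = (\<lambda>j\<in>{..<s}. (\<Sum>k<n. x (k * s + j)) / n)"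

lemma group_index_less:
  fixes s n j k :: nat
  assumes "j < s" "k < n"
  shows "k * s + j < s * n"
proof -
  have "k * s + j < Suc k * s" using assms by simp
  also have "\<dots> \<le> n * s" using assms by (intro mult_right_mono) auto
  finally show ?thesis by (simp add: mult.commute)
qed

section \<open>Properties of the lift\<close>

context
  fixes s n d :: nat and H :: cpoly
  assumes H: "H \<in> cpolys s" and deg: "total_degree_le d H"
begin

lemma slot_less: "\<alpha> \<in> Poly_Mapping.keys H \<Longrightarrow> p \<in> slots \<alpha> \<Longrightarrow> fst p < s"
  using H by (fastforce simp: cpolys_def slots_def)

lemma card_slots_le: "\<alpha> \<in> Poly_Mapping.keys H \<Longrightarrow> card (slots \<alpha>) \<le> d"
  using deg by (simp add: card_slots total_degree_le_def)

text \<open>Division by \<open>s\<close> recovers \<open>f p\<close> from the index, since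
  \<open>fst p < s\<close>; injectivity of \<open>f\<close> then carries over. Hence distinct slots
  receive distinct variables.\<close>

lemma inj_on_slot_var:
  assumes "\<alpha> \<in> Poly_Mapping.keys H" "f \<in> inj_maps (slots \<alpha>) n"
  shows "inj_on (slot_var s f) (slots \<alpha>)"
proof (rule inj_onI)
  fix p q assume pq: "p \<in> slots \<alpha>" "q \<in> slots \<alpha>" "slot_var s f p = slot_var s f q"
  have "slot_var s f r div s = f r" if "r \<in> slots \<alpha>" for r
    using slot_less[OF assms(1) that] by (simp add: slot_var_def)
  with pq have "f p = f q" by metis
  then show "p = q" using assms(2) pq by (auto simp: inj_maps_def dest: inj_onD)
qed

lemma slot_var_less:
  assumes "\<alpha> \<in> Poly_Mapping.keys H" "f \<in> slots \<alpha> \<rightarrow>\<^sub>E {..<n}" "p \<in> slots \<alpha>"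
  shows "slot_var s f p < s * n"
  using slot_less[OF assms(1,3)] assms(2,3)
  by (auto simp: slot_var_def intro!: group_index_less)

lemma lift_poly_in: "lift_poly s n H \<in> multiaffine_polys (s * n) d"
proof -
  have "Poly_Mapping.keys \<beta> \<subseteq> {..<s * n} \<and> monom_degree \<beta> \<le> d \<and>
      (\<forall>i. Poly_Mapping.lookup \<beta> i \<in> {0, 1})"
    if lift: "\<beta> \<in> Poly_Mapping.keys (lift_poly s n H)" for \<beta>
  proof -
    obtain \<alpha> where \<alpha>: "\<alpha> \<in> Poly_Mapping.keys H"
      and "\<beta> \<in> Poly_Mapping.keys (\<Sum>f\<in>inj_maps (slots \<alpha>) n.
        Poly_Mapping.single (squarefree_monom (slot_var s f ` slots \<alpha>))
          (Poly_Mapping.lookup H \<alpha> / card (inj_maps (slots \<alpha>) n)))"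
      using in_keys_sumD[OF lift[unfolded lift_poly_def]] by blast
    from in_keys_sumD[OF this(2)] obtain f where f: "f \<in> inj_maps (slots \<alpha>) n"
      and "\<beta> \<in> Poly_Mapping.keys (Poly_Mapping.single
        (squarefree_monom (slot_var s f ` slots \<alpha>))
          (Poly_Mapping.lookup H \<alpha> / card (inj_maps (slots \<alpha>) n)))"
      by blast
    then have \<beta>: "\<beta> = squarefree_monom (slot_var s f ` slots \<alpha>)"
      by (simp split: if_splits)
    have keys: "Poly_Mapping.keys \<beta> = slot_var s f ` slots \<alpha>"
      and lookup: "Poly_Mapping.lookup \<beta> i = of_bool (i \<in> slot_var s f ` slots \<alpha>)" for i
      unfolding \<beta> by (simp_all add: keys_squarefree_monom lookup_squarefree_monom)
    have "slot_var s f ` slots \<alpha> \<subseteq> {..<s * n}"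
      using slot_var_less[OF \<alpha>] f by (auto simp: inj_maps_def)
    moreover have "monom_degree \<beta> = card (slot_var s f ` slots \<alpha>)"
      by (simp add: monom_degree_def keys lookup)
    \<comment> \<open>The image has at most as many elements as there are slots, and these number
      the degree of \<open>\<alpha>\<close>.\<close>
    moreover have "card (slot_var s f ` slots \<alpha>) \<le> d"
      using card_image_le[OF finite_slots] card_slots_le[OF \<alpha>] by (rule order_trans)
    ultimately show ?thesis by (simp add: keys lookup)
  qed
  then show ?thesis
    by (simp add: multiaffine_polys_def cpolys_def multiaffine_def total_degree_le_def)
qed

lemma lift_poly_eval:
  "cpoly_eval (lift_poly s n H) x = (\<Sum>\<alpha>\<in>Poly_Mapping.keys H. Poly_Mapping.lookup H \<alpha> *
     ((\<Sum>f\<in>inj_maps (slots \<alpha>) n. \<Prod>p\<in>slots \<alpha>. x (slot_var s f p)) / card (inj_maps (slots \<alpha>) n)))"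
proof -
  have "monom_eval (squarefree_monom (slot_var s f ` slots \<alpha>)) x = (\<Prod>p\<in>slots \<alpha>. x (slot_var s f p))"
    if "\<alpha> \<in> Poly_Mapping.keys H" "f \<in> inj_maps (slots \<alpha>) n" for \<alpha> f
    using inj_on_slot_var[OF that]
    by (simp add: keys_squarefree_monom lookup_squarefree_monom prod.reindex)
  then show ?thesis
    by (simp add: lift_poly_def cpoly_eval_sum cpoly_eval_single sum_distrib_left sum_divide_distrib)
qed

text \<open>Variable \<open>v\<close> belongs to group \<open>v mod s\<close>, so the point gives
  every copy of variable j the value z_j. All products in an average then coincide with the original
  monomial.\<close>

lemma lift_poly_eval_diagonal:
  assumes "d \<le> n"
  shows "cpoly_eval (lift_poly s n H) (\<lambda>v\<in>{..<s * n}. z (v mod s)) = cpoly_eval H z"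
  unfolding lift_poly_eval
  unfolding cpoly_eval_def
proof (intro sum.cong refl arg_cong2[of _ _ _ _ "(*)"])
  fix \<alpha> assume \<alpha>: "\<alpha> \<in> Poly_Mapping.keys H"
  have "(\<Prod>p\<in>slots \<alpha>. (\<lambda>v\<in>{..<s * n}. z (v mod s)) (slot_var s f p)) = monom_eval \<alpha> z"
    if f: "f \<in> inj_maps (slots \<alpha>) n" for f
    unfolding prod_slots[symmetric]
  proof (rule prod.cong)
    fix p assume p: "p \<in> slots \<alpha>"
    have "slot_var s f p < s * n"
      using f slot_var_less[OF \<alpha> _ p] by (simp add: inj_maps_def)
    moreover have "slot_var s f p mod s = fst p"
      using slot_less[OF \<alpha> p] by (simp add: slot_var_def)
    ultimately show "(\<lambda>v\<in>{..<s * n}. z (v mod s)) (slot_var s f p) = z (fst p)" by simp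
  qed simp
  \<comment> \<open>\<open>d \<le> n\<close> guarantees an injective map, so the average is not a
    division by 0.\<close>
  moreover have "card (inj_maps (slots \<alpha>) n) \<noteq> 0"
    using inj_maps_nonempty[of "slots \<alpha>" n] card_slots_le[OF \<alpha>] assms
    by (simp add: finite_inj_maps)
  ultimately show "(\<Sum>f\<in>inj_maps (slots \<alpha>) n.
      \<Prod>p\<in>slots \<alpha>. (\<lambda>v\<in>{..<s * n}. z (v mod s)) (slot_var s f p)) /
      of_nat (card (inj_maps (slots \<alpha>) n)) = monom_eval \<alpha> z"
    by simp
qed

text \<open>Expanding a product of sums by distributivity chooses a copy for each slot
  independently, hence all maps appear and not only the injective ones.\<close>

lemma monom_eval_group_mean:
  assumes \<alpha>: "\<alpha> \<in> Poly_Mapping.keys H"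
  shows "monom_eval \<alpha> (group_mean s n x) =
    (\<Sum>f\<in>slots \<alpha> \<rightarrow>\<^sub>E {..<n}. \<Prod>p\<in>slots \<alpha>. x (slot_var s f p)) / card (slots \<alpha> \<rightarrow>\<^sub>E {..<n})"
proof -
  have "monom_eval \<alpha> (group_mean s n x) = (\<Prod>p\<in>slots \<alpha>. (\<Sum>k<n. x (k * s + fst p)) / n)"
    unfolding prod_slots[symmetric] using slot_less[OF \<alpha>]
    by (intro prod.cong) (auto simp: group_mean_def)
  then show ?thesis
    by (simp add: prod_dividef prod_sum_PiE card_funcsetE slot_var_def)
qed

text \<open>Monomial by monomial, an average over injective maps is compared with the average over
  all maps; on the unit polydisc every averaged product has modulus at most 1.\<close>

lemma lift_poly_group_mean_diff:
  assumes "d \<le> n" and x: "x \<in> cpower (cball 0 1) (s * n)"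
  shows "cmod (cpoly_eval (lift_poly s n H) x - cpoly_eval H (group_mean s n x)) \<le>
    (\<Sum>\<alpha>\<in>Poly_Mapping.keys H. cmod (Poly_Mapping.lookup H \<alpha>) *
       (2 * (1 - card (inj_maps (slots \<alpha>) n) / real n ^ card (slots \<alpha>))))"
  unfolding lift_poly_eval
  unfolding cpoly_eval_def sum_subtractf[symmetric] right_diff_distrib[symmetric]
proof (rule sum_norm_le)
  fix \<alpha> assume \<alpha>: "\<alpha> \<in> Poly_Mapping.keys H"
  define g where "g = (\<lambda>f. \<Prod>p\<in>slots \<alpha>. x (slot_var s f p))"
  have "cmod (sum g (inj_maps (slots \<alpha>) n) / card (inj_maps (slots \<alpha>) n) -
      sum g (slots \<alpha> \<rightarrow>\<^sub>E {..<n}) / card (slots \<alpha> \<rightarrow>\<^sub>E {..<n}))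
      \<le> 2 * (1 - card (inj_maps (slots \<alpha>) n) / card (slots \<alpha> \<rightarrow>\<^sub>E {..<n}))"
  proof (rule norm_average_subset_diff_le)
    show "inj_maps (slots \<alpha>) n \<noteq> {}"
      using inj_maps_nonempty[of "slots \<alpha>" n] card_slots_le[OF \<alpha>] assms by simp
    show "cmod (g f) \<le> 1" if "f \<in> slots \<alpha> \<rightarrow>\<^sub>E {..<n}" for f
      unfolding g_def prod_norm[symmetric]
      using x slot_var_less[OF \<alpha> that] by (intro prod_le_1) (auto simp: cpower_def PiE_iff)
  qed (auto simp: inj_maps_def finite_PiE)
  then show "cmod (Poly_Mapping.lookup H \<alpha> *
      ((\<Sum>f\<in>inj_maps (slots \<alpha>) n. \<Prod>p\<in>slots \<alpha>. x (slot_var s f p)) / card (inj_maps (slots \<alpha>) n) -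
       monom_eval \<alpha> (group_mean s n x)))
      \<le> cmod (Poly_Mapping.lookup H \<alpha>) *
        (2 * (1 - card (inj_maps (slots \<alpha>) n) / real n ^ card (slots \<alpha>)))"
    unfolding monom_eval_group_mean[OF \<alpha>] norm_mult
    by (intro mult_left_mono) (auto simp: g_def card_funcsetE)
qed

end

lemma group_mean_in_real_cube:
  assumes x: "x \<in> sign_cube (s * n)" and "n > 0"
  shows "group_mean s n x \<in> real_cube s"
proof -
  have "(\<Sum>k<n. x (k * s + j)) / n \<in> complex_of_real ` {-1..1}" if "j < s" for j
  proof -
    \<comment> \<open>Signs are real, so the mean can be estimated through real parts.\<close>
    have x': "x (k * s + j) = of_real (Re (x (k * s + j))) \<and> \<bar>Re (x (k * s + j))\<bar> \<le> 1" if "k < n" for k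
      using x group_index_less[OF \<open>j < s\<close> that] by (force simp: sign_cube_def cpower_def PiE_iff)
    have "\<bar>\<Sum>k<n. Re (x (k * s + j))\<bar> \<le> n"
      using sum_norm_bound[of "{..<n}" "\<lambda>k. Re (x (k * s + j))" 1] x' by auto
    then have "(\<Sum>k<n. Re (x (k * s + j))) / n \<in> {-1..1}"
      using \<open>n > 0\<close> by (auto simp: field_simps)
    moreover have "(\<Sum>k<n. x (k * s + j)) / n = of_real ((\<Sum>k<n. Re (x (k * s + j))) / n)"
      using x' by simp
    ultimately show ?thesis by blast
  qed
  then show ?thesis
    by (auto simp: real_cube_def cpower_def group_mean_def)
qed

section \<open>Comparison of the constants\<close>

lemma sign_cube_const_upper:
  assumes "N \<ge> d" "P \<in> multiaffine_polys N d" "P \<noteq> 0"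
  shows "ereal (sup_norm_on (torus N) P / sup_norm_on (sign_cube N) P) \<le> sign_cube_const d"
  unfolding sign_cube_const_def using assms by (intro SUP_upper2[of N] SUP_upper) auto

text \<open>The constant polynomial 1 is admissible. This settles the cases below where a quotient
  is 0 and excludes the value minus infinity.\<close>

lemma sign_cube_const_nonneg: "sign_cube_const d \<ge> 0"
proof -
  have 1: "(1 :: cpoly) \<in> multiaffine_polys d d" "(1 :: cpoly) \<noteq> 0"
    by (auto simp: multiaffine_polys_def cpolys_def multiaffine_def total_degree_le_def
        monom_degree_def)
  then have "1 \<in> cpolys d" by (simp add: multiaffine_polys_def)
  then have "0 \<le> ereal (sup_norm_on (torus d) 1 / sup_norm_on (sign_cube d) 1)"
    by (simp add: sup_norm_on_nonneg[OF _ torus_subset torus_nonempty]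
        sup_norm_on_nonneg[OF _ sign_cube_subset_unit sign_cube_nonempty])
  also have "\<dots> \<le> sign_cube_const d"
    by (rule sign_cube_const_upper[OF order_refl 1])
  finally show ?thesis .
qed

text \<open>With \<open>z\<close> fixed, the lifts take the value of \<open>H\<close> at
  \<open>z\<close> on the torus, while their sign cube norms exceed that of \<open>H\<close> on the
  real cube by at most an error tending to 0.\<close>

lemma sign_cube_const_ge_pointwise:
  assumes s: "s \<ge> 1" and d: "d \<ge> 1" and H: "H \<in> cpolys s" "total_degree_le d H"
    and pos: "sup_norm_on (real_cube s) H > 0" and z: "z \<in> torus s"
  shows "ereal (cmod (cpoly_eval H z) / sup_norm_on (real_cube s) H) \<le> sign_cube_const d"
proof (cases "cpoly_eval H z = 0")
  case True
  then show ?thesis by (simp add: sign_cube_const_nonneg flip: zero_ereal_def)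
next
  case False
  define M where "M = sup_norm_on (real_cube s) H"
  define \<epsilon> where "\<epsilon> n = (\<Sum>\<alpha>\<in>Poly_Mapping.keys H. cmod (Poly_Mapping.lookup H \<alpha>) *
       (2 * (1 - card (inj_maps (slots \<alpha>) n) / real n ^ card (slots \<alpha>))))" for n
  have "\<epsilon> \<longlonglongrightarrow> (\<Sum>\<alpha>\<in>Poly_Mapping.keys H. cmod (Poly_Mapping.lookup H \<alpha>) * (2 * (1 - 1)))"
    unfolding \<epsilon>_def by (intro tendsto_intros inj_maps_ratio_tendsto) simp
  \<comment> \<open>The limit of the denominators is \<open>M > 0\<close>, so the quotients
    converge.\<close>
  then have "(\<lambda>n. cmod (cpoly_eval H z) / (M + \<epsilon> n)) \<longlonglongrightarrow> cmod (cpoly_eval H z) / (M + 0)"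
    using pos by (intro tendsto_intros) (auto simp: M_def)
  then have lim: "(\<lambda>n. ereal (cmod (cpoly_eval H z) / (M + \<epsilon> n)))
      \<longlonglongrightarrow> ereal (cmod (cpoly_eval H z) / M)"
    by simp
  have "ereal (cmod (cpoly_eval H z) / (M + \<epsilon> n)) \<le> sign_cube_const d" if n: "n \<ge> d" for n
  proof -
    define P where "P = lift_poly s n H"
    define w where "w = (\<lambda>v\<in>{..<s * n}. z (v mod s))"
    have P: "P \<in> multiaffine_polys (s * n) d"
      unfolding P_def by (rule lift_poly_in[OF H])
    then have P': "P \<in> cpolys (s * n)" "multiaffine P"
      by (auto simp: multiaffine_polys_def)
    have eval_w: "cpoly_eval P w = cpoly_eval H z"
      unfolding P_def w_def by (rule lift_poly_eval_diagonal[OF H n])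
    have w: "w \<in> torus (s * n)"
      using z s by (auto simp: w_def torus_def cpower_def PiE_iff)
    have sign_pos: "sup_norm_on (sign_cube (s * n)) P > 0"
      using sup_norm_on_sign_cube_pos[OF P' w] False eval_w by simp
    have "sup_norm_on (sign_cube (s * n)) P \<le> M + \<epsilon> n"
    proof (rule sup_norm_on_le[OF sign_cube_nonempty])
      fix x assume x: "x \<in> sign_cube (s * n)"
      have "cmod (cpoly_eval P x - cpoly_eval H (group_mean s n x)) \<le> \<epsilon> n"
        unfolding P_def \<epsilon>_def
        using x sign_cube_subset_unit
        by (intro lift_poly_group_mean_diff[OF H n]) blast
      moreover have "cmod (cpoly_eval H (group_mean s n x)) \<le> M"
        unfolding M_def using group_mean_in_real_cube[OF x] n d
        by (intro norm_cpoly_eval_le_sup_norm_on[OF H(1) real_cube_subset]) simp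
      ultimately show "cmod (cpoly_eval P x) \<le> M + \<epsilon> n"
        using norm_triangle_sub[of "cpoly_eval P x" "cpoly_eval H (group_mean s n x)"] by linarith
    qed
    \<comment> \<open>The numerator grows since \<open>w\<close> lies on the torus, and the
      denominator shrinks but stays positive.\<close>
    then have "cmod (cpoly_eval H z) / (M + \<epsilon> n) \<le>
        sup_norm_on (torus (s * n)) P / sup_norm_on (sign_cube (s * n)) P"
      using norm_cpoly_eval_le_sup_norm_on[OF P'(1) torus_subset w] sign_pos
        norm_ge_zero[of "cpoly_eval P w"]
      unfolding eval_w by (intro frac_le) linarith+
    moreover have "s * n \<ge> d"
      using s n mult_le_mono[of 1 s d n] by simp
    moreover have "P \<noteq> 0"
      using eval_w False by auto
    ultimately show ?thesis
      using sign_cube_const_upper[OF _ P] by (meson ereal_less_eq(3) order_trans)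
  qed
  then show ?thesis
    using LIMSEQ_le_const2[OF lim] unfolding M_def by blast
qed

lemma sign_cube_const_ge:
  assumes s: "s \<ge> 1" and d: "d \<ge> 1" and H: "H \<in> cpolys s" "total_degree_le d H"
  shows "ereal (sup_norm_on (torus s) H / sup_norm_on (real_cube s) H) \<le> sign_cube_const d"
proof (cases "sup_norm_on (real_cube s) H > 0")
  case False
  have "0 \<le> sup_norm_on (real_cube s) H"
    by (rule sup_norm_on_nonneg[OF H(1) real_cube_subset real_cube_nonempty])
  \<comment> \<open>With denominator 0 the quotient is 0 by the convention for division.\<close>
  with False have "sup_norm_on (real_cube s) H = 0" by simp
  then show ?thesis
    by (simp add: sign_cube_const_nonneg flip: zero_ereal_def)
next
  case True
  note bound = sign_cube_const_ge_pointwise[OF s d H True]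
  show ?thesis
  \<comment> \<open>If the constant is finite, clearing the denominator turns the pointwise bound
    into one uniform in \<open>z\<close>, and the supremum over the torus can be taken.\<close>
  proof (cases "sign_cube_const d")
    case (real c)
    then have "sup_norm_on (torus s) H \<le> c * sup_norm_on (real_cube s) H"
      using bound True by (intro sup_norm_on_le[OF torus_nonempty]) (simp add: pos_divide_le_eq)
    then show ?thesis using real True by (simp add: pos_divide_le_eq)
  next
    case MInf
    then show ?thesis using sign_cube_const_nonneg[of d] by simp
  qed simp
qed

theorem theorem1:
  fixes d :: nat
  assumes "d \<ge> 1"
  shows "sign_cube_const d = real_cube_const d"
proof (rule antisym)
  show "sign_cube_const d \<le> real_cube_const d"
    unfolding sign_cube_const_def
  proof (intro SUP_least)
    fix N P assume N: "N \<in> {d..}" and "P \<in> multiaffine_polys N d - {0}"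
    then have P: "P \<in> cpolys N" "multiaffine P" "total_degree_le d P" "P \<noteq> 0"
      by (auto simp: multiaffine_polys_def)
    \<comment> \<open>\<open>P\<close> itself competes in \<open>real_cube_const\<close> with
      \<open>s = N\<close>, and \<open>N \<ge> d \<ge> 1\<close>.\<close>
    show "ereal (sup_norm_on (torus N) P / sup_norm_on (sign_cube N) P) \<le> real_cube_const d"
      unfolding real_cube_const_def sup_norm_on_real_cube_multiaffine[OF P(1,2), symmetric]
      using N P assms by (intro SUP_upper2[of N] SUP_upper) auto
  qed
  show "real_cube_const d \<le> sign_cube_const d"
    unfolding real_cube_const_def
    using assms by (intro SUP_least sign_cube_const_ge) auto
qed

end
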